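(* Let $G$ be a finitely generated group acting on the right on a non-empty set $X$. Suppose that $G$ separates $X$ and that the Frattini subgroup $\Phi(G)$ has finite index in $G$. Then $G$ satisfies no almost-identity.
   Context: A group $G$ acting by permutations on a set $X$ separates $X$ if for every finite subset $Y\subseteq X$, the set of points of $X$ fixed by every element of the fixator (pointwise stabilizer) $G_Y$ of $Y$ is equal to $Y$. The Frattini subgroup $\Phi(G)$ is the intersection of all maximal subgroups of $G$. A non-trivial word $w$ in the free group on $x_1,\dots,x_k$ is a $k$-almost-identity for $G$ if $w(g_1,\dots,g_k)=1$ for all $g_1,\dots,g_k\in G$ such that $\{g_1,\dots,g_k\}$ generates $G$. The group $G$ satisfies an almost-identity if for every positive integer $k$ there exists a $k$-almost-identity for $G$; otherwise it satisfies no almost-identity. *)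

theory Defs
  imports "HOL-Algebra.Generated_Groups"
begin

section \<open>Finite generation and the Frattini subgroup\<close>

definition finitely_generated_group :: "('a, 'm) monoid_scheme \<Rightarrow> bool" where
  "finitely_generated_group G \<longleftrightarrow>
     group G \<and> (\<exists>S. finite S \<and> S \<subseteq> carrier G \<and> generate G S = carrier G)"

definition maximal_subgroup :: "'a set \<Rightarrow> ('a, 'm) monoid_scheme \<Rightarrow> bool" where
  "maximal_subgroup M G \<longleftrightarrow>
     subgroup M G \<and> M \<noteq> carrier G \<and>
     (\<forall>H. subgroup H G \<longrightarrow> M \<subseteq> H \<longrightarrow> H = M \<or> H = carrier G)"

text \<open>The intersection is taken inside \<open>carrier G\<close>, so a group without maximal subgroups
  is its own Frattini subgroup.\<close>

definition frattini :: "('a, 'm) monoid_scheme \<Rightarrow> 'a set" where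
  "frattini G = carrier G \<inter> \<Inter> {M. maximal_subgroup M G}"

definition finite_index :: "'a set \<Rightarrow> ('a, 'm) monoid_scheme \<Rightarrow> bool" where
  "finite_index H G \<longleftrightarrow> subgroup H G \<and> finite (rcosets\<^bsub>G\<^esub> H)"

lemma subgroup_frattini:
  assumes "group G"
  shows "subgroup (frattini G) G"
proof -
  interpret group G by fact
  have "frattini G = \<Inter> (insert (carrier G) {M. maximal_subgroup M G})"
    by (simp add: frattini_def)
  moreover have "subgroup (\<Inter> (insert (carrier G) {M. maximal_subgroup M G})) G"
    by (rule subgroups_Inter) (auto simp: maximal_subgroup_def subgroup_self)
  ultimately show ?thesis by simp
qed

section \<open>Right actions\<close>

text \<open>\<open>act x g\<close> is the image of the point \<open>x\<close> under \<open>g\<close>.  The library locale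
  \<open>group_action\<close> describes left actions; here \<open>act x (g \<otimes> h)\<close> applies \<open>g\<close> first.
  The action need not be faithful.\<close>

locale right_group_action = group G
  for G :: "('a, 'm) monoid_scheme" (structure) and \<Omega> :: "'x set" and act :: "'x \<Rightarrow> 'a \<Rightarrow> 'x" +
  assumes act_closed: "\<lbrakk>x \<in> \<Omega>; g \<in> carrier G\<rbrakk> \<Longrightarrow> act x g \<in> \<Omega>"
    and act_one: "x \<in> \<Omega> \<Longrightarrow> act x \<one>\<^bsub>G\<^esub> = x"
    and act_mult: "\<lbrakk>x \<in> \<Omega>; g \<in> carrier G; h \<in> carrier G\<rbrakk>
      \<Longrightarrow> act x (g \<otimes>\<^bsub>G\<^esub> h) = act (act x g) h"

definition fixator :: "('a, 'm) monoid_scheme \<Rightarrow> ('x \<Rightarrow> 'a \<Rightarrow> 'x) \<Rightarrow> 'x set \<Rightarrow> 'a set" where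
  "fixator G act Y = {g \<in> carrier G. \<forall>y\<in>Y. act y g = y}"

definition fixed_points :: "'x set \<Rightarrow> ('x \<Rightarrow> 'a \<Rightarrow> 'x) \<Rightarrow> 'a set \<Rightarrow> 'x set" where
  "fixed_points \<Omega> act H = {x \<in> \<Omega>. \<forall>h\<in>H. act x h = x}"

definition separates :: "('a, 'm) monoid_scheme \<Rightarrow> 'x set \<Rightarrow> ('x \<Rightarrow> 'a \<Rightarrow> 'x) \<Rightarrow> bool" where
  "separates G \<Omega> act \<longleftrightarrow>
     (\<forall>Y. finite Y \<and> Y \<subseteq> \<Omega> \<longrightarrow> fixed_points \<Omega> act (fixator G act Y) = Y)"

section \<open>The free group of rank k\<close>

text \<open>The letter \<open>(i, True)\<close> stands for the generator with index \<open>i\<close> and \<open>(i, False)\<close> for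
  its inverse; indices run through \<open>{..<k}\<close>.  The elements of the free group are the
  freely reduced words, multiplied by concatenation followed by free reduction.\<close>

type_synonym letter = "nat \<times> bool"

fun inv_letter :: "letter \<Rightarrow> letter" where
  "inv_letter (i, b) = (i, \<not> b)"

definition reduced :: "letter list \<Rightarrow> bool" where
  "reduced w \<longleftrightarrow> successively (\<lambda>a b. b \<noteq> inv_letter a) w"

fun cons_reduce :: "letter \<Rightarrow> letter list \<Rightarrow> letter list" where
  "cons_reduce a [] = [a]"
| "cons_reduce a (b # w) = (if b = inv_letter a then w else a # b # w)"

definition free_group :: "nat \<Rightarrow> letter list monoid" where
  "free_group k =
     \<lparr>carrier = {w. reduced w \<and> fst ` set w \<subseteq> {..<k}},
      mult = foldr cons_reduce,
      one = []\<rparr>"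

fun letter_value :: "('a, 'm) monoid_scheme \<Rightarrow> (nat \<Rightarrow> 'a) \<Rightarrow> letter \<Rightarrow> 'a" where
  "letter_value G g (i, b) = (if b then g i else inv\<^bsub>G\<^esub> (g i))"

definition word_value :: "('a, 'm) monoid_scheme \<Rightarrow> (nat \<Rightarrow> 'a) \<Rightarrow> letter list \<Rightarrow> 'a" where
  "word_value G g w = foldr (\<lambda>a y. letter_value G g a \<otimes>\<^bsub>G\<^esub> y) w \<one>\<^bsub>G\<^esub>"

lemma inv_letter_inv [simp]: "inv_letter (inv_letter a) = a"
  by (cases a) simp

lemma inv_letter_neq [simp]: "inv_letter a \<noteq> a" "a \<noteq> inv_letter a"
  by (cases a; simp)+

lemma fst_inv_letter [simp]: "fst (inv_letter a) = fst a"
  by (cases a) simp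

lemma reduced_Nil [simp]: "reduced []"
  by (simp add: reduced_def)

lemma reduced_Cons: "reduced (a # w) \<longleftrightarrow> reduced w \<and> (w = [] \<or> hd w \<noteq> inv_letter a)"
  by (cases w) (auto simp: reduced_def)

lemma reduced_cons_reduce: "reduced w \<Longrightarrow> reduced (cons_reduce a w)"
  by (cases w) (auto simp: reduced_Cons)

lemma cons_reduce_cancel: "reduced w \<Longrightarrow> cons_reduce (inv_letter a) (cons_reduce a w) = w"
  by (cases w; cases "tl w") (auto simp: reduced_Cons)

lemma reduced_foldr_cons_reduce: "reduced w \<Longrightarrow> reduced (foldr cons_reduce v w)"
  by (induction v) (auto intro: reduced_cons_reduce)

lemma letters_cons_reduce: "set (cons_reduce a w) \<subseteq> insert a (set w)"
  by (cases w) auto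

lemma letters_foldr_cons_reduce: "set (foldr cons_reduce v w) \<subseteq> set v \<union> set w"
proof (induction v)
  case (Cons a v)
  then show ?case using letters_cons_reduce[of a "foldr cons_reduce v w"] by auto
qed simp

lemma foldr_cons_reduce_cons_reduce:
  assumes "reduced w"
  shows "foldr cons_reduce (cons_reduce a v) w = cons_reduce a (foldr cons_reduce v w)"
proof (cases v)
  case (Cons b u)
  show ?thesis
  proof (cases "b = inv_letter a")
    case True
    then show ?thesis
      using Cons cons_reduce_cancel[OF reduced_foldr_cons_reduce[OF assms], of "inv_letter a" u]
      by simp
  qed (simp add: Cons)
qed simp

lemma foldr_cons_reduce_assoc:
  "reduced w \<Longrightarrow>
    foldr cons_reduce (foldr cons_reduce u v) w = foldr cons_reduce u (foldr cons_reduce v w)"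
  by (induction u) (simp_all add: foldr_cons_reduce_cons_reduce)

lemma foldr_cons_reduce_Nil: "reduced w \<Longrightarrow> foldr cons_reduce w [] = w"
proof (induction w)
  case (Cons a w)
  then show ?case by (cases w) (auto simp: reduced_Cons)
qed simp

lemma foldr_cons_reduce_inverse:
  "reduced v \<Longrightarrow> foldr cons_reduce (rev (map inv_letter w)) (foldr cons_reduce w v) = v"
  by (induction w) (simp_all add: cons_reduce_cancel reduced_foldr_cons_reduce)

lemma group_free_group: "group (free_group k)"
proof (rule groupI)
  fix x y
  assume xy: "x \<in> carrier (free_group k)" "y \<in> carrier (free_group k)"
  then show "x \<otimes>\<^bsub>free_group k\<^esub> y \<in> carrier (free_group k)"
    using letters_foldr_cons_reduce[of x y]
    by (fastforce simp: free_group_def reduced_foldr_cons_reduce)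
next
  fix x
  assume x: "x \<in> carrier (free_group k)"
  define y where "y = foldr cons_reduce (rev (map inv_letter x)) []"
  have "set y \<subseteq> set (rev (map inv_letter x))"
    using letters_foldr_cons_reduce[of "rev (map inv_letter x)" "[]"] by (simp add: y_def)
  hence "fst ` set y \<subseteq> fst ` set x"
    by force
  hence "y \<in> carrier (free_group k)"
    using x by (auto simp: free_group_def y_def reduced_foldr_cons_reduce)
  moreover have "y \<otimes>\<^bsub>free_group k\<^esub> x = \<one>\<^bsub>free_group k\<^esub>"
  proof -
    have "reduced x" using x by (simp add: free_group_def)
    then show ?thesis
      using foldr_cons_reduce_inverse[of "[]" x]
      by (simp add: free_group_def y_def foldr_cons_reduce_assoc foldr_cons_reduce_Nil)
  qed
  ultimately show "\<exists>y\<in>carrier (free_group k). y \<otimes>\<^bsub>free_group k\<^esub> x = \<one>\<^bsub>free_group k\<^esub>"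
    by blast
qed (auto simp: free_group_def foldr_cons_reduce_assoc)

context group
begin

lemma letter_value_closed:
  "g (fst a) \<in> carrier G \<Longrightarrow> letter_value G g a \<in> carrier G"
  by (cases a) auto

lemma letter_value_inv_letter:
  "g (fst a) \<in> carrier G \<Longrightarrow> letter_value G g (inv_letter a) = inv (letter_value G g a)"
  by (cases a) auto

lemma word_value_closed:
  "(\<And>i. i \<in> fst ` set w \<Longrightarrow> g i \<in> carrier G) \<Longrightarrow> word_value G g w \<in> carrier G"
  by (induction w) (auto simp: word_value_def intro!: letter_value_closed)

lemma word_value_cons_reduce:
  assumes "\<And>i. i \<in> insert (fst a) (fst ` set w) \<Longrightarrow> g i \<in> carrier G"
  shows "word_value G g (cons_reduce a w) = letter_value G g a \<otimes> word_value G g w"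
proof (cases w)
  case (Cons b u)
  have "word_value G g u \<in> carrier G" "letter_value G g a \<in> carrier G"
    using assms Cons by (auto intro!: word_value_closed letter_value_closed)
  then show ?thesis
    using assms by (auto simp: Cons word_value_def letter_value_inv_letter m_assoc[symmetric])
qed (simp add: word_value_def)

lemma word_value_hom:
  assumes "\<And>i. i < k \<Longrightarrow> g i \<in> carrier G"
  shows "word_value G g \<in> hom (free_group k) G"
proof (rule homI)
  fix u v
  assume u: "u \<in> carrier (free_group k)" and v: "v \<in> carrier (free_group k)"
  have val: "word_value G g w \<in> carrier G" if "fst ` set w \<subseteq> {..<k}" for w
    using that assms by (intro word_value_closed) auto
  have "word_value G g (foldr cons_reduce u v) = word_value G g u \<otimes> word_value G g v"
    if "fst ` set u \<subseteq> {..<k}" "fst ` set v \<subseteq> {..<k}" for u v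
    using that
  proof (induction u)
    case Nil
    then show ?case using val by (simp add: word_value_def[of G g "[]"])
  next
    case (Cons a u)
    have "fst ` set (foldr cons_reduce u v) \<subseteq> {..<k}"
      using letters_foldr_cons_reduce[of u v] Cons.prems by fastforce
    hence "word_value G g (cons_reduce a (foldr cons_reduce u v))
        = letter_value G g a \<otimes> word_value G g (foldr cons_reduce u v)"
      using Cons.prems assms by (intro word_value_cons_reduce) auto
    also have "\<dots> = letter_value G g a \<otimes> (word_value G g u \<otimes> word_value G g v)"
      using Cons by simp
    also have "\<dots> = word_value G g (a # u) \<otimes> word_value G g v"
      using Cons.prems assms val
      by (simp add: word_value_def[of G g "a # u"] word_value_def[of G g u, symmetric]
          letter_value_closed m_assoc)
    finally show ?case by simp
  qed
  then show "word_value G g (u \<otimes>\<^bsub>free_group k\<^esub> v) = word_value G g u \<otimes> word_value G g v"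
    using u v by (simp add: free_group_def)
qed (use assms in \<open>auto simp: free_group_def intro!: word_value_closed\<close>)

end

section \<open>Almost-identities\<close>

definition almost_identity :: "nat \<Rightarrow> letter list \<Rightarrow> ('a, 'm) monoid_scheme \<Rightarrow> bool" where
  "almost_identity k w G \<longleftrightarrow>
     w \<in> carrier (free_group k) \<and> w \<noteq> \<one>\<^bsub>free_group k\<^esub> \<and>
     (\<forall>g. g ` {..<k} \<subseteq> carrier G \<longrightarrow> generate G (g ` {..<k}) = carrier G
        \<longrightarrow> word_value G g w = \<one>\<^bsub>G\<^esub>)"

definition satisfies_almost_identity :: "('a, 'm) monoid_scheme \<Rightarrow> bool" where
  "satisfies_almost_identity G \<longleftrightarrow> (\<forall>k>0. \<exists>w. almost_identity k w G)"

end

theory Submission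
  imports Defs
begin

text \<open>Elements of the Frattini subgroup can be multiplied into the members of a generating
  tuple without losing generation, and since \<open>\<Phi>(G)\<close> has finite index, the fixator in \<open>\<Phi>(G)\<close> of
  a finite set \<open>Y\<close> has only infinite orbits outside \<open>Y\<close>.  Following Abert, one reads a
  reduced word letter by letter and keeps correcting a generating tuple by elements of \<open>\<Phi>(G)\<close> so
  that the trajectory of a point under the prefixes of the word never returns to a point visited
  before.  In particular the word moves the starting point, so its value is not trivial.\<close>

section \<open>Maximal subgroups and the Frattini subgroup under finite generation\<close>

context group
begin

lemma inv_mult_cancel_left [simp]:
  "\<lbrakk>x \<in> carrier G; y \<in> carrier G\<rbrakk> \<Longrightarrow> inv x \<otimes> (x \<otimes> y) = y"
  by (simp add: m_assoc[symmetric])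

lemma subgroup_Union_chain:
  assumes "\<C> \<noteq> {}" and sub: "\<And>H. H \<in> \<C> \<Longrightarrow> subgroup H G"
    and chain: "\<And>H K. \<lbrakk>H \<in> \<C>; K \<in> \<C>\<rbrakk> \<Longrightarrow> H \<subseteq> K \<or> K \<subseteq> H"
  shows "subgroup (\<Union>\<C>) G"
proof (rule subgroupI)
  show "\<Union>\<C> \<subseteq> carrier G" using subgroup.subset[OF sub] by blast
  show "\<Union>\<C> \<noteq> {}" using assms(1) subgroup.one_closed[OF sub] by blast
  show "inv a \<in> \<Union>\<C>" if "a \<in> \<Union>\<C>" for a
    using that subgroup.m_inv_closed[OF sub] by blast
  show "a \<otimes> b \<in> \<Union>\<C>" if ab: "a \<in> \<Union>\<C>" "b \<in> \<Union>\<C>" for a b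
  proof -
    obtain H K where HK: "a \<in> H" "H \<in> \<C>" "b \<in> K" "K \<in> \<C>" using ab by blast
    then have "H \<subseteq> K \<or> K \<subseteq> H" by (intro chain)
    with HK obtain L where L: "a \<in> L" "b \<in> L" "L \<in> \<C>" by blast
    then show ?thesis using subgroup.m_closed[OF sub[OF L(3)] L(1,2)] by blast
  qed
qed

text \<open>Zorn's lemma on the proper subgroups above \<open>H\<close>. Finiteness of
  \<open>S\<close> keeps the union of a chain proper: otherwise \<open>S\<close> would already lie
  inside one member of the chain, which would then be all of \<open>G\<close>.\<close>

lemma proper_subgroup_le_maximal:
  assumes "finite S" "S \<subseteq> carrier G" and gen: "generate G S = carrier G"
    and H: "subgroup H G" "H \<noteq> carrier G"
  obtains M where "maximal_subgroup M G" "H \<subseteq> M"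
proof -
  let ?A = "{K. subgroup K G \<and> K \<noteq> carrier G \<and> H \<subseteq> K}"
  have proper: "K = carrier G" if "subgroup K G" "S \<subseteq> K" for K
    using generate_subgroup_incl[OF that(2,1)] gen subgroup.subset[OF that(1)] by blast
  have "\<exists>M\<in>?A. \<forall>X\<in>?A. M \<subseteq> X \<longrightarrow> X = M"
  proof (rule subset_Zorn_nonempty)
    show "?A \<noteq> {}" using H by blast
    fix \<C> assume ne: "\<C> \<noteq> {}" and ch: "subset.chain ?A \<C>"
    have subA: "\<C> \<subseteq> ?A" and tot: "\<And>H K. \<lbrakk>H \<in> \<C>; K \<in> \<C>\<rbrakk> \<Longrightarrow> H \<subseteq> K \<or> K \<subseteq> H"
      using ch by (auto simp: subset_chain_def)
    have "subgroup (\<Union>\<C>) G"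
      by (rule subgroup_Union_chain[OF ne]) (use subA tot in auto)
    moreover have "\<Union>\<C> \<noteq> carrier G"
    proof
      assume "\<Union>\<C> = carrier G"
      then have "S \<subseteq> \<Union>\<C>" using assms(2) by simp
      then obtain K where K: "K \<in> \<C>" "S \<subseteq> K"
        using finite_subset_Union_chain[OF assms(1) _ ne ch] by blast
      with subA have "subgroup K G" "K \<noteq> carrier G" by auto
      then show False using proper K(2) by simp
    qed
    moreover have "H \<subseteq> \<Union>\<C>" using ne subA by blast
    ultimately show "\<Union>\<C> \<in> ?A" by blast
  qed
  then obtain M where M: "subgroup M G" "M \<noteq> carrier G" "H \<subseteq> M"
    and max: "\<And>K. K \<in> ?A \<Longrightarrow> M \<subseteq> K \<Longrightarrow> K = M"
    by auto
  have "K = M \<or> K = carrier G" if "subgroup K G" "M \<subseteq> K" for K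
    using max[of K] that M(3) by auto
  then have "maximal_subgroup M G" using M by (simp add: maximal_subgroup_def)
  then show thesis using that M(3) by simp
qed

lemma frattini_le_maximal: "maximal_subgroup M G \<Longrightarrow> frattini G \<subseteq> M"
  by (auto simp: frattini_def)

text \<open>If \<open>T\<close> generated a proper subgroup, some maximal subgroup would contain
  \<open>T\<close>, hence \<open>S\<close>, hence everything. Generation can thus be tested on
  maximal subgroups alone.\<close>

lemma generate_eq_carrier_if_maximal:
  assumes "finite S" "S \<subseteq> carrier G" "generate G S = carrier G" "T \<subseteq> carrier G"
    and max: "\<And>M. \<lbrakk>maximal_subgroup M G; T \<subseteq> M\<rbrakk> \<Longrightarrow> S \<subseteq> M"
  shows "generate G T = carrier G"
proof (rule ccontr)
  assume "generate G T \<noteq> carrier G"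
  then obtain M where M: "maximal_subgroup M G" "generate G T \<subseteq> M"
    by (rule proper_subgroup_le_maximal[OF assms(1-3) generate_is_subgroup[OF assms(4)]])
  have "T \<subseteq> M" using M(2) generate.incl[of _ T G] by (meson subset_iff)
  then have "S \<subseteq> M" by (rule max[OF M(1)])
  moreover have sub: "subgroup M G" and ne: "M \<noteq> carrier G"
    using M(1) by (auto simp: maximal_subgroup_def)
  ultimately have "carrier G \<subseteq> M"
    using generate_subgroup_incl[of S M] assms(3) by simp
  then show False using ne subgroup.subset[OF sub] by blast
qed

text \<open>Only values of generators can be changed, so when \<open>l\<close> is an inverse letter
  the generator receives \<open>inv v\<close>. In both cases \<open>l\<close> itself evaluates to
  \<open>v\<close>.\<close>

lemma letter_value_update_index:
  assumes "a = l \<or> a = inv_letter l" "v \<in> carrier G"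
  shows "letter_value G (g(fst l := if snd l then v else inv v)) a
    = (if a = l then v else inv v)"
  using assms by (cases l; cases a) auto

lemma letter_value_mem_iff:
  assumes "subgroup H G" "g (fst l) \<in> carrier G"
  shows "letter_value G g l \<in> H \<longleftrightarrow> g (fst l) \<in> H"
proof -
  have "inv (g (fst l)) \<in> H \<longleftrightarrow> g (fst l) \<in> H"
    using subgroup.m_inv_closed[OF assms(1), of "g (fst l)"]
      subgroup.m_inv_closed[OF assms(1), of "inv (g (fst l))"] inv_inv[OF assms(2)] by auto
  then show ?thesis by (cases l) auto
qed

text \<open>A maximal subgroup containing the new tuple also contains \<open>h\<close>. Cancelling
  \<open>h\<close> puts the old value of \<open>l\<close> into it, and with that the whole old
  generating tuple.\<close>

lemma generate_frattini_update:
  fixes g :: "nat \<Rightarrow> 'a"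
  assumes g: "g ` {..<k} \<subseteq> carrier G" "generate G (g ` {..<k}) = carrier G"
    and l: "fst l < k" and h: "h \<in> frattini G"
    and g': "g' = g(fst l := if snd l then h \<otimes> letter_value G g l
                              else inv (h \<otimes> letter_value G g l))"
  shows "g' ` {..<k} \<subseteq> carrier G" "generate G (g' ` {..<k}) = carrier G"
proof -
  let ?v = "letter_value G g l"
  have hc: "h \<in> carrier G" using h by (simp add: frattini_def)
  have vc: "?v \<in> carrier G" using g(1) l by (intro letter_value_closed) auto
  show c: "g' ` {..<k} \<subseteq> carrier G" using g(1) hc vc by (auto simp: g')
  have val: "letter_value G g' l = h \<otimes> ?v"
    using letter_value_update_index[of l l "h \<otimes> ?v" g] hc vc by (simp add: g')
  show "generate G (g' ` {..<k}) = carrier G"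
  proof (rule generate_eq_carrier_if_maximal[OF _ g c])
    fix M assume M: "maximal_subgroup M G" and sub: "g' ` {..<k} \<subseteq> M"
    then have sg: "subgroup M G" by (simp add: maximal_subgroup_def)
    have hM: "h \<in> M" using frattini_le_maximal[OF M] h by blast
    have "h \<otimes> ?v \<in> M"
      using letter_value_mem_iff[OF sg, of g' l] c sub l val by (auto simp: image_subset_iff)
    then have "inv h \<otimes> (h \<otimes> ?v) \<in> M"
      using hM sg by (simp add: subgroup.m_closed subgroup.m_inv_closed)
    then have "?v \<in> M" using hc vc by simp
    then have "g (fst l) \<in> M"
      using letter_value_mem_iff[OF sg, of g l] g(1) l by (auto simp: image_subset_iff)
    moreover have "g i \<in> M" if "i < k" "i \<noteq> fst l" for i
      using that sub by (auto simp: g' image_subset_iff split: if_splits)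
    ultimately show "g ` {..<k} \<subseteq> M" by blast
  qed simp
qed

end

section \<open>Infinite orbits of fixators\<close>

context right_group_action
begin

lemma act_inv_cancel [simp]:
  "\<lbrakk>x \<in> \<Omega>; g \<in> carrier G\<rbrakk> \<Longrightarrow> act (act x g) (inv g) = x"
  by (simp add: act_mult[symmetric] act_one)

lemma act_eq_iff:
  "\<lbrakk>x \<in> \<Omega>; y \<in> \<Omega>; g \<in> carrier G\<rbrakk> \<Longrightarrow> act x g = act y g \<longleftrightarrow> x = y"
  by (metis act_inv_cancel)

lemma act_inv_fixed:
  "\<lbrakk>x \<in> \<Omega>; g \<in> carrier G; act x g = x\<rbrakk> \<Longrightarrow> act x (inv g) = x"
  by (metis act_inv_cancel)

lemma subgroup_fixator:
  assumes "Y \<subseteq> \<Omega>"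
  shows "subgroup (fixator G act Y) G"
proof (rule subgroupI)
  show "fixator G act Y \<subseteq> carrier G" by (auto simp: fixator_def)
  have "\<one> \<in> fixator G act Y" using assms act_one by (auto simp: fixator_def)
  then show "fixator G act Y \<noteq> {}" by blast
  show "inv a \<in> fixator G act Y" if "a \<in> fixator G act Y" for a
    using that assms act_inv_fixed unfolding fixator_def by blast
  show "a \<otimes> b \<in> fixator G act Y" if "a \<in> fixator G act Y" "b \<in> fixator G act Y" for a b
    using that assms by (auto simp: fixator_def act_mult subset_iff)
qed

text \<open>If the orbit were finite, its points other than \<open>x\<close> could be added to
  \<open>Y\<close>. The fixator of the enlarged set \<open>Z\<close> can only send \<open>x\<close>
  to itself or into \<open>Z\<close>; the latter is excluded because points of \<open>Z\<close> are
  fixed and the action is injective. So \<open>x\<close> is fixed, against separation.\<close>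

lemma infinite_orbit_fixator:
  assumes sep: "separates G \<Omega> act" and Y: "finite Y" "Y \<subseteq> \<Omega>" and x: "x \<in> \<Omega>" "x \<notin> Y"
  shows "infinite (act x ` fixator G act Y)"
proof
  let ?O = "act x ` fixator G act Y"
  assume fin: "finite ?O"
  define Z where "Z = Y \<union> (?O - {x})"
  have O: "?O \<subseteq> \<Omega>" using x act_closed by (auto simp: fixator_def)
  have "act x h = x" if h: "h \<in> fixator G act Z" for h
  proof (rule ccontr)
    assume ne: "act x h \<noteq> x"
    have hc: "h \<in> carrier G" and "h \<in> fixator G act Y"
      using h by (auto simp: fixator_def Z_def)
    with ne have "act x h \<in> Z" by (auto simp: Z_def)
    then have "act (act x h) h = act x h" using h by (simp add: fixator_def)
    with ne show False using act_eq_iff[of "act x h" x h] act_closed x hc by simp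
  qed
  then have "x \<in> fixed_points \<Omega> act (fixator G act Z)"
    using x by (simp add: fixed_points_def)
  moreover have "finite Z" "Z \<subseteq> \<Omega>" using fin O Y by (auto simp: Z_def)
  ultimately have "x \<in> Z" using sep unfolding separates_def by blast
  then show False using x by (simp add: Z_def)
qed

text \<open>The fixator meets only finitely many cosets of \<open>H\<close>, so its orbit of
  \<open>x\<close> is covered by finitely many translates of the orbit under the intersection with
  \<open>H\<close>.\<close>

lemma infinite_orbit_finite_index:
  assumes sep: "separates G \<Omega> act" and H: "finite_index H G"
    and Y: "finite Y" "Y \<subseteq> \<Omega>" and x: "x \<in> \<Omega>" "x \<notin> Y"
  shows "infinite (act x ` (H \<inter> fixator G act Y))"
proof
  let ?F = "fixator G act Y"
  assume fin: "finite (act x ` (H \<inter> ?F))"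
  have sH: "subgroup H G" and fc: "finite (rcosets H)" using H by (auto simp: finite_index_def)
  have sF: "subgroup ?F G" using subgroup_fixator[OF Y(2)] .
  \<comment> \<open>A representative inside the fixator for each coset that meets it. On other
    cosets the value is arbitrary, which is harmless since every translate of a finite set is
    finite.\<close>
  define r where "r C = (SOME c. c \<in> C \<inter> ?F)" for C
  have "act x ` ?F \<subseteq> (\<Union>C\<in>rcosets H. (\<lambda>y. act y (r C)) ` act x ` (H \<inter> ?F))"
  proof
    fix y assume "y \<in> act x ` ?F"
    then obtain g where g: "g \<in> ?F" "y = act x g" by blast
    have gc: "g \<in> carrier G" using g by (simp add: fixator_def)
    let ?C = "H #> g"
    have C: "?C \<in> rcosets H" using gc by (auto simp: RCOSETS_def)
    have "g \<in> ?C \<inter> ?F" using rcos_self[OF gc sH] g by blast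
    then have "r ?C \<in> ?C \<inter> ?F" unfolding r_def by (rule someI)
    then have rC: "r ?C \<in> ?C" and rF: "r ?C \<in> ?F" by auto
    have rc: "r ?C \<in> carrier G" using rF by (simp add: fixator_def)
    obtain h where h: "h \<in> H" "r ?C = h \<otimes> g" using rC by (auto simp: r_coset_def)
    have hc: "h \<in> carrier G" using h sH subgroup.subset by blast
    have "g \<otimes> inv (r ?C) = inv h"
      using hc gc by (simp add: h inv_mult_group m_assoc[symmetric])
    then have "g \<otimes> inv (r ?C) \<in> H" using h sH by (simp add: subgroup.m_inv_closed)
    moreover have "g \<otimes> inv (r ?C) \<in> ?F"
      using g rF sF by (simp add: subgroup.m_inv_closed subgroup.m_closed)
    moreover have "y = act (act x (g \<otimes> inv (r ?C))) (r ?C)"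
      using x gc rc by (simp add: act_mult[symmetric] m_assoc g)
    ultimately show "y \<in> (\<Union>C\<in>rcosets H. (\<lambda>y. act y (r C)) ` act x ` (H \<inter> ?F))"
      using C by blast
  qed
  then have "finite (act x ` ?F)"
    by (rule finite_subset) (use fc fin in blast)
  then show False using infinite_orbit_fixator[OF sep Y x] by blast
qed

section \<open>Trajectories of a point along a word\<close>

definition trajectory :: "(nat \<Rightarrow> 'a) \<Rightarrow> letter list \<Rightarrow> 'x list \<Rightarrow> bool" where
  "trajectory g w xs \<longleftrightarrow> length xs = Suc (length w) \<and> set xs \<subseteq> \<Omega> \<and> distinct xs \<and>
     (\<forall>j<length w. act (xs ! j) (letter_value G g (w ! j)) = xs ! Suc j)"

text \<open>In a right action the first letter of the word acts first, so the list runs through the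
  images of its head under the successive prefixes.\<close>

lemma trajectory_word_value:
  assumes "length xs = Suc (length w)" "set xs \<subseteq> \<Omega>" "\<And>i. i \<in> fst ` set w \<Longrightarrow> g i \<in> carrier G"
    and "\<And>j. j < length w \<Longrightarrow> act (xs ! j) (letter_value G g (w ! j)) = xs ! Suc j"
  shows "act (hd xs) (word_value G g w) = last xs"
  using assms
proof (induction w arbitrary: xs)
  case Nil
  then show ?case by (cases xs) (auto simp: word_value_def act_one)
next
  case (Cons a w)
  obtain x ys where xs: "xs = x # ys" "length ys = Suc (length w)"
    using Cons.prems(1) by (cases xs) auto
  have yne: "ys \<noteq> []" using xs by auto
  have "act (hd ys) (word_value G g w) = last ys"
  proof (rule Cons.IH[OF xs(2)])
    show "act (ys ! j) (letter_value G g (w ! j)) = ys ! Suc j" if "j < length w" for j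
      using Cons.prems(4)[of "Suc j"] that xs by simp
  qed (use Cons.prems xs in auto)
  moreover have "act x (letter_value G g a) = hd ys"
    using Cons.prems(4)[of 0] xs yne by (simp add: hd_conv_nth)
  moreover have "letter_value G g a \<in> carrier G"
    using Cons.prems(3) by (intro letter_value_closed) simp
  moreover have "word_value G g w \<in> carrier G"
    using Cons.prems(3) by (intro word_value_closed) simp
  moreover have "word_value G g (a # w) = letter_value G g a \<otimes> word_value G g w"
    by (simp add: word_value_def)
  ultimately show ?case using Cons.prems(2) xs yne by (simp add: act_mult)
qed

text \<open>The value \<open>v\<close> of the new letter \<open>l\<close> is replaced by
  \<open>h \<otimes> v\<close>. Choosing \<open>h\<close> in the Frattini subgroup preserves
  generation, letting it fix \<open>D\<close> preserves the earlier steps, and an infinite orbit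
  leaves room to send the endpoint outside the trajectory.\<close>

lemma trajectory_extend:
  assumes sep: "separates G \<Omega> act" and fi: "finite_index (frattini G) G"
    and g: "g ` {..<k} \<subseteq> carrier G" "generate G (g ` {..<k}) = carrier G"
    and w: "fst ` set (w @ [l]) \<subseteq> {..<k}" "reduced (w @ [l])"
    and tr: "trajectory g w xs"
  obtains g' y where "g' ` {..<k} \<subseteq> carrier G" "generate G (g' ` {..<k}) = carrier G"
    "trajectory g' (w @ [l]) (xs @ [y])"
proof -
  let ?n = "length w" and ?v = "letter_value G g l" and ?x = "last xs"
  have len: "length xs = Suc ?n" and xs: "set xs \<subseteq> \<Omega>" "distinct xs"
    and step: "\<And>j. j < ?n \<Longrightarrow> act (xs ! j) (letter_value G g (w ! j)) = xs ! Suc j"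
    using tr by (auto simp: trajectory_def)
  have xne: "xs \<noteq> []" using len by auto
  have xl: "?x = xs ! ?n" using len xne by (simp add: last_conv_nth)
  have xO: "?x \<in> \<Omega>" using xs xne last_in_set by blast
  have nthO: "xs ! j \<in> \<Omega>" if "j \<le> ?n" for j using that len xs nth_mem[of j xs] by auto
  have lk: "fst l < k" using w by auto
  have vc: "?v \<in> carrier G" using g(1) lk by (intro letter_value_closed) auto
  txt \<open>The points of the trajectory at which the value of \<open>l\<close> has already been used.\<close>
  define D where "D = {xs ! j |j. j < ?n \<and> w ! j = l}
                    \<union> {xs ! Suc j |j. j < ?n \<and> w ! j = inv_letter l}"
  have Dsub: "D \<subseteq> set xs" using len by (auto simp: D_def)
  then have D: "finite D" "D \<subseteq> \<Omega>" using xs finite_subset by auto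
  \<comment> \<open>Reducedness enters here: if \<open>w\<close> ended in the inverse of
    \<open>l\<close>, the current endpoint would belong to \<open>D\<close> and \<open>h\<close>
    could not move it.\<close>
  have last_letter: "w ! j \<noteq> inv_letter l" if "Suc j = ?n" for j
  proof
    assume a: "w ! j = inv_letter l"
    have "w \<noteq> []" using that by auto
    then have "last w = inv_letter l" using a that by (metis last_conv_nth diff_Suc_1)
    with w(2) \<open>w \<noteq> []\<close> show False
      by (auto simp: reduced_def successively_append_iff)
  qed
  \<comment> \<open>The endpoint has index \<open>?n\<close>. By distinctness it could occur in
    \<open>D\<close> only as \<open>xs ! Suc j\<close> with \<open>Suc j = ?n\<close>, the case just
    excluded.\<close>
  have "?x \<notin> D"
    unfolding xl D_def using xs(2) len last_letter by (auto simp: nth_eq_iff_index_eq)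
  then have inf: "infinite (act ?x ` (frattini G \<inter> fixator G act D))"
    using infinite_orbit_finite_index[OF sep fi D xO] by blast
  \<comment> \<open>The points to avoid are pulled back along \<open>?v\<close>: the new endpoint
    hits \<open>xs\<close> precisely when the image of \<open>?x\<close> under \<open>h\<close> lies
    in this finite set.\<close>
  have "\<not> act ?x ` (frattini G \<inter> fixator G act D) \<subseteq> (\<lambda>z. act z (inv ?v)) ` set xs"
    using inf finite_subset[OF _ finite_imageI[OF finite_set]] by blast
  then obtain h where h: "h \<in> frattini G" "h \<in> fixator G act D"
      and hx: "act ?x h \<notin> (\<lambda>z. act z (inv ?v)) ` set xs"
    unfolding image_subset_iff by blast
  have hc: "h \<in> carrier G" using h by (simp add: frattini_def)
  define g' where "g' = g(fst l := if snd l then h \<otimes> ?v else inv (h \<otimes> ?v))"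
  define y where "y = act ?x (h \<otimes> ?v)"
  have yO: "y \<in> \<Omega>" using xO hc vc by (simp add: y_def act_closed)
  have "act y (inv ?v) = act ?x h" using xO hc vc by (simp add: y_def act_mult act_closed)
  with hx have yn: "y \<notin> set xs" by force
  have fixD: "act z h = z" if "z \<in> D" for z using h that by (simp add: fixator_def)
  have val: "letter_value G g' a = (if a = l then h \<otimes> ?v else inv (h \<otimes> ?v))"
    if "a = l \<or> a = inv_letter l" for a
    unfolding g'_def by (rule letter_value_update_index[OF that]) (use hc vc in simp)
  have old: "act (xs ! j) (letter_value G g' (w ! j)) = xs ! Suc j" if j: "j < ?n" for j
  proof -
    consider "w ! j = l" | "w ! j = inv_letter l" | "fst (w ! j) \<noteq> fst l"
      by (cases "w ! j"; cases l) auto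
    then show ?thesis
    proof cases
      case 1
      then have "xs ! j \<in> D" using j by (auto simp: D_def)
      then show ?thesis
        using 1 step[OF j] val[of l] fixD nthO[of j] j hc vc by (simp add: act_mult)
    next
      case 2
      \<comment> \<open>Here the new letter value is \<open>inv ?v \<otimes> inv h\<close>, so
        \<open>h\<close> has to fix the point reached, not the point left. This is why
        \<open>D\<close> uses the index \<open>Suc j\<close> for inverse letters.\<close>
      then have inD: "xs ! Suc j \<in> D" using j by (auto simp: D_def)
      have "letter_value G g (w ! j) = inv ?v"
        using 2 g(1) lk by (auto simp: letter_value_inv_letter image_subset_iff)
      then have "act (xs ! j) (inv ?v) = xs ! Suc j" using step[OF j] by simp
      moreover have "act (xs ! Suc j) (inv h) = xs ! Suc j"
        using act_inv_fixed[OF _ hc fixD[OF inD]] nthO[of "Suc j"] j by simp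
      ultimately show ?thesis
        using 2 val[of "inv_letter l"] nthO[of j] j hc vc by (simp add: inv_mult_group act_mult)
    next
      case 3
      then have "letter_value G g' (w ! j) = letter_value G g (w ! j)"
        by (cases "w ! j") (auto simp: g'_def)
      then show ?thesis using step[OF j] by simp
    qed
  qed
  have "trajectory g' (w @ [l]) (xs @ [y])"
    unfolding trajectory_def
  proof (intro conjI allI impI)
    fix j assume "j < length (w @ [l])"
    then consider "j < ?n" | "j = ?n" by fastforce
    then show "act ((xs @ [y]) ! j) (letter_value G g' ((w @ [l]) ! j)) = (xs @ [y]) ! Suc j"
    proof cases
      case 1
      then show ?thesis using old[of j] len by (simp add: nth_append)
    next
      case 2
      then show ?thesis using val[of l] len by (simp add: nth_append xl[symmetric] y_def)
    qed
  qed (use len xs yO yn in auto)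
  then show thesis
    using that generate_frattini_update[OF g lk h(1) g'_def] by blast
qed

text \<open>Letters are appended at the right end, since prefixes of a reduced word are reduced. The
  tuple may change at each stage, but each stage yields one tuple valid for the entire
  prefix.\<close>

lemma ex_trajectory:
  assumes sep: "separates G \<Omega> act" and fi: "finite_index (frattini G) G" and "\<Omega> \<noteq> {}"
    and g: "g ` {..<k} \<subseteq> carrier G" "generate G (g ` {..<k}) = carrier G"
    and w: "fst ` set w \<subseteq> {..<k}" "reduced w"
  shows "\<exists>g' xs. g' ` {..<k} \<subseteq> carrier G \<and> generate G (g' ` {..<k}) = carrier G
    \<and> trajectory g' w xs"
  using w
proof (induction w rule: rev_induct)
  case Nil
  obtain x where "x \<in> \<Omega>" using assms(3) by blast
  then have "trajectory g [] [x]" by (simp add: trajectory_def)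
  then show ?case using g by blast
next
  case (snoc l w)
  have "reduced w" using snoc.prems by (auto simp: reduced_def successively_append_iff)
  then obtain g' xs where "g' ` {..<k} \<subseteq> carrier G" "generate G (g' ` {..<k}) = carrier G"
    "trajectory g' w xs" using snoc by auto
  from trajectory_extend[OF sep fi this(1,2) snoc.prems this(3)] show ?case by metis
qed

text \<open>A non-empty word has a trajectory with at least two points, all distinct, whereas a
  trivial value would make its two ends coincide.\<close>

lemma no_almost_identity:
  assumes "separates G \<Omega> act" "finite_index (frattini G) G" "\<Omega> \<noteq> {}"
    and "g ` {..<k} \<subseteq> carrier G" "generate G (g ` {..<k}) = carrier G"
  shows "\<not> almost_identity k w G"
proof
  assume ai: "almost_identity k w G"
  then have w: "fst ` set w \<subseteq> {..<k}" "reduced w" "w \<noteq> []"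
    by (auto simp: almost_identity_def free_group_def)
  obtain g' xs where g': "g' ` {..<k} \<subseteq> carrier G" "generate G (g' ` {..<k}) = carrier G"
    and tr: "trajectory g' w xs"
    using ex_trajectory[OF assms w(1,2)] by blast
  have len: "length xs = Suc (length w)" and xs: "set xs \<subseteq> \<Omega>" "distinct xs"
    and step: "\<And>j. j < length w \<Longrightarrow> act (xs ! j) (letter_value G g' (w ! j)) = xs ! Suc j"
    using tr by (auto simp: trajectory_def)
  have "act (hd xs) (word_value G g' w) = last xs"
    by (rule trajectory_word_value[OF len xs(1) _ step]) (use g'(1) w(1) in blast)+
  moreover have "word_value G g' w = \<one>" using ai g' by (simp add: almost_identity_def)
  moreover have "hd xs \<in> \<Omega>" using xs(1) len by (cases xs) auto
  ultimately have "hd xs = last xs" by (simp add: act_one)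
  then show False using xs(2) len w(3) by (cases xs) (auto split: if_splits)
qed

end

theorem theorem6p10:
  fixes G :: "('a, 'm) monoid_scheme"
    and \<Omega> :: "'x set"
    and act :: "'x \<Rightarrow> 'a \<Rightarrow> 'x"
  assumes "finitely_generated_group G"
    and "right_group_action G \<Omega> act"
    and "\<Omega> \<noteq> {}"
    and "separates G \<Omega> act"
    and "finite_index (frattini G) G"
  shows "\<not> satisfies_almost_identity G"
proof -
  interpret right_group_action G \<Omega> act by fact
  obtain S where S: "finite S" "S \<subseteq> carrier G" "generate G S = carrier G"
    using assms(1) by (auto simp: finitely_generated_group_def)
  \<comment> \<open>Adjoining the identity keeps the set generating and makes its cardinality
    positive even when \<open>S\<close> is empty, as the bound \<open>k > 0\<close> demands.\<close>
  let ?T = "insert \<one>\<^bsub>G\<^esub> S"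
  have T: "finite ?T" "?T \<subseteq> carrier G" using S by auto
  have "generate G ?T = carrier G"
    using mono_generate[of S ?T] S(3) generate_incl[OF T(2)] by blast
  moreover obtain g where "bij_betw g {0..<card ?T} ?T"
    using ex_bij_betw_nat_finite[OF T(1)] by blast
  then have "g ` {..<card ?T} = ?T" by (simp add: bij_betw_def atLeast0LessThan)
  ultimately have "\<not> almost_identity (card ?T) w G" for w
    using no_almost_identity[OF assms(4,5,3), of g "card ?T"] T(2) by metis
  moreover have "card ?T > 0" using T(1) card_gt_0_iff by blast
  ultimately show ?thesis unfolding satisfies_almost_identity_def by blast
qed

end
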